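(* Let $p>3$ be a prime. Then $$\sum_{k=0}^{p-1}(2pk-2k-1)\frac{\left(\frac{-1}{p-1}\right)_k^{\,2p-2}}{(k!)^{2p-2}}\equiv 0 \pmod{p^5}.$$
   Context: $(x)_k=x(x+1)\cdots(x+k-1)$ denotes the Pochhammer symbol (with $(x)_0=1$). Congruences between rational numbers are understood in the ring of rationals whose denominators are prime to $p$. *)

theory Defs
  imports Complex_Main "HOL-Computational_Algebra.Primes"
begin

text \<open>
  The ring of rationals whose denominator in lowest terms is prime to \<open>p\<close>
  (\<open>quotient_of\<close> returns the reduced fraction with positive denominator).
\<close>

definition p_integral_rats :: "nat \<Rightarrow> rat set" where
  "p_integral_rats p = {x. coprime (snd (quotient_of x)) (int p)}"

text \<open>
  Congruence modulo the principal ideal generated by \<open>m\<close> in that ring.  (Congruence in the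
  field of all rationals would be trivial: the cofactor \<open>c\<close> must be \<open>p\<close>-integral.)
\<close>

definition rat_cong :: "nat \<Rightarrow> rat \<Rightarrow> rat \<Rightarrow> rat \<Rightarrow> bool" where
  "rat_cong p m a b \<longleftrightarrow>
     a \<in> p_integral_rats p \<and> b \<in> p_integral_rats p \<and>
     (\<exists>c \<in> p_integral_rats p. a - b = m * c)"

end

theory Submission
  imports Defs
begin

text \<open>
  Put \<open>n = p - 1\<close> and \<open>t = - p / n\<close>, so that \<open>- 1 / n = 1 + t\<close> and the \<open>k\<close>-th term of the sum is
  \<open>(2 n k - 1) F k\<close> with \<open>F k = (\<Prod>j = 1..k. 1 + t / j) ^ (2 n)\<close>.  Since \<open>n t = - p\<close>, the
  binomial expansion gives, modulo \<open>p ^ 5\<close> and for \<open>p\<close>-integral \<open>x\<close>,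
  \<open>(1 + t x) ^ n (1 + p x) = 1 + (p ^ 3 + p ^ 4) / 2 x ^ 2 - 2 / 3 p ^ 4 x ^ 3\<close>.
  Squaring with \<open>x = 1 / k\<close>,
  \<open>(k + p) ^ 2 F k = F (k - 1) (k ^ 2 + p ^ 3 + p ^ 4 - 4 / 3 p ^ 4 / k)\<close>.
  Summing this over \<open>0 < k < p\<close>, the left side minus \<open>k ^ 2 F (k - 1)\<close> rearranges into the sum
  in question plus \<open>p ^ 2 S + p ^ 2 (F (p - 1) - 1)\<close>, where \<open>S = \<Sum>k<p. F k\<close>.  It remains to know
  modulo \<open>p ^ 3\<close> that \<open>F (p - 1) = 1\<close>, which is Wolstenholme's theorem in disguise, and that
  \<open>S = - p - 2 p ^ 2\<close>, which follows from the same recurrence by summing \<open>k (F k - F (k - 1))\<close>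
  by parts.
\<close>

section \<open>The ring of rationals integral at \<open>p\<close>\<close>

text \<open>The fraction need not be in lowest terms: the reduced denominator divides
  \<open>b\<close>, hence inherits coprimality to \<open>p\<close>.\<close>

lemma p_integral_ratsI:
  assumes "coprime b (int p)" "b \<noteq> 0" "x = of_int a / of_int b"
  shows "x \<in> p_integral_rats p"
proof -
  obtain c d where cd: "quotient_of x = (c, d)" by force
  have d: "d > 0" "coprime c d" and x: "x = of_int c / of_int d"
    using cd quotient_of_denom_pos quotient_of_coprime quotient_of_div by auto
  have "(of_int (c * b) :: rat) = of_int (a * d)"
    using assms(2) d(1) frac_eq_eq[of "of_int d" "of_int b" "of_int c" "of_int a :: rat"]
    by (simp add: x[unfolded assms(3), symmetric])
  then have "c * b = a * d"
    by (simp only: of_int_eq_iff)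
  then have "d dvd c * b" by simp
  then have "d dvd b"
    using d(2) by (simp add: coprime_commute coprime_dvd_mult_right_iff)
  then have "coprime d (int p)"
    by (rule coprime_divisors[OF _ dvd_refl assms(1)])
  then show ?thesis
    by (simp add: p_integral_rats_def cd)
qed

lemma p_integral_ratsE:
  assumes "x \<in> p_integral_rats p"
  obtains a b where "coprime b (int p)" "b \<noteq> 0" "x = of_int a / of_int b"
proof -
  obtain c d where cd: "quotient_of x = (c, d)" by force
  show ?thesis
    using that[of d c] assms cd quotient_of_denom_pos[OF cd] quotient_of_div[OF cd]
    by (simp add: p_integral_rats_def)
qed

lemma p_integral_of_int [simp]: "of_int a \<in> p_integral_rats p"
  by (rule p_integral_ratsI[of 1 _ _ a]) auto

lemma p_integral_of_nat [simp]: "of_nat a \<in> p_integral_rats p"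
  using p_integral_of_int[of "int a"] by simp

lemma p_integral_0 [simp]: "0 \<in> p_integral_rats p"
  and p_integral_1 [simp]: "1 \<in> p_integral_rats p"
  and p_integral_numeral [simp]: "numeral w \<in> p_integral_rats p"
  using p_integral_of_int[of 0] p_integral_of_int[of 1] p_integral_of_int[of "numeral w"]
  by simp_all

lemma p_integral_add [simp]:
  assumes "x \<in> p_integral_rats p" "y \<in> p_integral_rats p"
  shows "x + y \<in> p_integral_rats p"
proof -
  from assms(1) obtain a b where 1: "coprime b (int p)" "b \<noteq> 0" "x = of_int a / of_int b"
    by (rule p_integral_ratsE)
  from assms(2) obtain c d where 2: "coprime d (int p)" "d \<noteq> 0" "y = of_int c / of_int d"
    by (rule p_integral_ratsE)
  show ?thesis
    using 1 2 by (intro p_integral_ratsI[of "b * d" _ _ "a * d + c * b"]) (auto simp: field_simps)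
qed

lemma p_integral_mult [simp]:
  assumes "x \<in> p_integral_rats p" "y \<in> p_integral_rats p"
  shows "x * y \<in> p_integral_rats p"
proof -
  from assms(1) obtain a b where 1: "coprime b (int p)" "b \<noteq> 0" "x = of_int a / of_int b"
    by (rule p_integral_ratsE)
  from assms(2) obtain c d where 2: "coprime d (int p)" "d \<noteq> 0" "y = of_int c / of_int d"
    by (rule p_integral_ratsE)
  show ?thesis
    using 1 2 by (intro p_integral_ratsI[of "b * d" _ _ "a * c"]) (auto simp: field_simps)
qed

lemma p_integral_uminus [simp]:
  "x \<in> p_integral_rats p \<Longrightarrow> - x \<in> p_integral_rats p"
  using p_integral_mult[OF p_integral_of_int[of "-1"]] by simp

lemma p_integral_diff [simp]:
  "x \<in> p_integral_rats p \<Longrightarrow> y \<in> p_integral_rats p \<Longrightarrow> x - y \<in> p_integral_rats p"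
  using p_integral_add[of x p "- y"] by simp

lemma p_integral_power [simp]:
  "x \<in> p_integral_rats p \<Longrightarrow> x ^ m \<in> p_integral_rats p"
  by (induction m) auto

lemma p_integral_sum [simp]:
  "(\<And>i. i \<in> A \<Longrightarrow> f i \<in> p_integral_rats p) \<Longrightarrow> sum f A \<in> p_integral_rats p"
  by (induction A rule: infinite_finite_induct) auto

lemma p_integral_prod [simp]:
  "(\<And>i. i \<in> A \<Longrightarrow> f i \<in> p_integral_rats p) \<Longrightarrow> prod f A \<in> p_integral_rats p"
  by (induction A rule: infinite_finite_induct) auto

lemma p_integral_divide_of_int:
  assumes "coprime b (int p)" "b \<noteq> 0" "x \<in> p_integral_rats p"
  shows "x / of_int b \<in> p_integral_rats p"
proof -
  have "1 / of_int b \<in> p_integral_rats p"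
    using assms by (intro p_integral_ratsI[of b _ _ 1]) auto
  then show ?thesis
    using p_integral_mult[OF assms(3)] by fastforce
qed

section \<open>Ideals generated by powers of \<open>p\<close>\<close>

text \<open>Congruences modulo \<open>p ^ e\<close> are written below as membership of a difference
  in this ideal, so that they combine by sums and \<open>p\<close>-integral multiples.\<close>

definition p_power_ideal :: "nat \<Rightarrow> nat \<Rightarrow> rat set" where
  "p_power_ideal p e = (\<lambda>c. of_nat p ^ e * c) ` p_integral_rats p"

lemma p_power_idealI:
  "c \<in> p_integral_rats p \<Longrightarrow> x = of_nat p ^ e * c \<Longrightarrow> x \<in> p_power_ideal p e"
  unfolding p_power_ideal_def by (rule image_eqI)

lemma p_power_ideal_integral: "x \<in> p_power_ideal p e \<Longrightarrow> x \<in> p_integral_rats p"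
  by (auto simp: p_power_ideal_def)

lemma p_power_ideal_0: "0 \<in> p_power_ideal p e"
  by (rule p_power_idealI[of 0]) auto

lemma p_power_ideal_add:
  assumes "x \<in> p_power_ideal p e" "y \<in> p_power_ideal p e"
  shows "x + y \<in> p_power_ideal p e"
  using assms unfolding p_power_ideal_def
  by (auto simp: distrib_left[symmetric])

lemma p_power_ideal_mult:
  assumes "x \<in> p_power_ideal p e" "y \<in> p_integral_rats p"
  shows "y * x \<in> p_power_ideal p e"
  using assms by (auto simp: p_power_ideal_def image_iff mult.left_commute)

lemma p_power_ideal_uminus:
  "x \<in> p_power_ideal p e \<Longrightarrow> - x \<in> p_power_ideal p e"
  using p_power_ideal_mult[of x p e "-1"] by simp

lemma p_power_ideal_diff:
  "x \<in> p_power_ideal p e \<Longrightarrow> y \<in> p_power_ideal p e \<Longrightarrow> x - y \<in> p_power_ideal p e"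
  using p_power_ideal_add[OF _ p_power_ideal_uminus] by fastforce

lemma p_power_ideal_sum:
  "(\<And>i. i \<in> A \<Longrightarrow> f i \<in> p_power_ideal p e) \<Longrightarrow> sum f A \<in> p_power_ideal p e"
  by (induction A rule: infinite_finite_induct) (auto intro: p_power_ideal_0 p_power_ideal_add)

lemma p_power_ideal_mult_power:
  assumes "x \<in> p_power_ideal p e"
  shows "of_nat p ^ d * x \<in> p_power_ideal p (d + e)"
  using assms by (auto simp: p_power_ideal_def power_add)

lemma p_power_ideal_mono:
  assumes "x \<in> p_power_ideal p e" "d \<le> e"
  shows "x \<in> p_power_ideal p d"
proof -
  obtain c where c: "c \<in> p_integral_rats p" "x = of_nat p ^ e * c"
    using assms by (auto simp: p_power_ideal_def)
  show ?thesis
    using c assms(2) by (intro p_power_idealI[of "of_nat p ^ (e - d) * c"])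
      (auto simp flip: power_add mult.assoc)
qed

text \<open>Every product of two or more terms \<open>p ^ e * f j\<close> carries a factor
  \<open>p ^ (2 * e)\<close>, so only the linear part survives.\<close>

lemma prod_one_plus_cong:
  assumes "finite A" "\<And>j. j \<in> A \<Longrightarrow> f j \<in> p_integral_rats p"
  shows "(\<Prod>j\<in>A. 1 + of_nat p ^ e * f j) - (1 + of_nat p ^ e * sum f A) \<in> p_power_ideal p (2 * e)"
  using assms
proof (induction A rule: finite_induct)
  case empty
  then show ?case by (simp add: p_power_ideal_0)
next
  case (insert j A)
  let ?q = "of_nat p ^ e :: rat"
  have "(\<Prod>i\<in>insert j A. 1 + ?q * f i) - (1 + ?q * sum f (insert j A))
      = (1 + ?q * f j) * ((\<Prod>i\<in>A. 1 + ?q * f i) - (1 + ?q * sum f A))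
        + of_nat p ^ (2 * e) * (f j * sum f A)"
    using insert.hyps unfolding mult_2 power_add by (simp add: algebra_simps)
  also have "\<dots> \<in> p_power_ideal p (2 * e)"
    using insert by (intro p_power_ideal_add p_power_ideal_mult p_power_idealI[OF _ refl]) auto
  finally show ?case .
qed

lemma power_cong_one:
  assumes "x - 1 \<in> p_power_ideal p e"
  shows "x ^ m - 1 \<in> p_power_ideal p e"
proof (induction m)
  case (Suc m)
  have "x \<in> p_integral_rats p"
    using p_integral_add[OF p_power_ideal_integral[OF assms] p_integral_1] by simp
  then have "x * (x ^ m - 1) + (x - 1) \<in> p_power_ideal p e"
    using Suc assms by (intro p_power_ideal_add p_power_ideal_mult)
  then show ?case
    by (simp add: algebra_simps)
qed (simp add: p_power_ideal_0)

section \<open>Units modulo a prime above 3\<close>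

locale prime_gt_3 =
  fixes p :: nat
  assumes prime_p: "prime p" and p_gt_3: "p > 3"
begin

abbreviation q :: rat where "q \<equiv> of_nat p"
abbreviation n :: rat where "n \<equiv> of_nat p - 1"
abbreviation t :: rat where "t \<equiv> - q / n"
abbreviation R :: "rat set" where "R \<equiv> p_integral_rats p"
abbreviation I :: "nat \<Rightarrow> rat set" where "I \<equiv> p_power_ideal p"

text \<open>This makes room for the five binomial terms of index below 5 when expanding a power with
  exponent \<open>p - 1\<close>.\<close>

lemma p_ge_5: "p \<ge> 5"
proof -
  have "p \<noteq> 4" using prime_odd_nat[OF prime_p] p_gt_3 by auto
  then show ?thesis using p_gt_3 by simp
qed

lemma n_neq_0: "n \<noteq> 0"
  using p_gt_3 by simp

lemma of_nat_pred: "of_nat (p - 1) = n"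
  using p_gt_3 by simp

lemma coprime_less:
  assumes "0 < j" "j < p"
  shows "coprime j p"
  using assms prime_p by (metis coprime_commute nat_dvd_not_less prime_imp_coprime)

lemma divide_of_nat_integral:
  assumes "0 < j" "j < p" "x \<in> R"
  shows "x / of_nat j \<in> R"
  using p_integral_divide_of_int[of "int j" p x] coprime_less[OF assms(1,2)] assms by auto

text \<open>With 2 and 3 invertible, so are the denominators 6, 8 and 24 of the expansions
  below.\<close>

lemma divide_2_integral: "x \<in> R \<Longrightarrow> x / 2 \<in> R"
  and divide_3_integral: "x \<in> R \<Longrightarrow> x / 3 \<in> R"
  using divide_of_nat_integral[of 2] divide_of_nat_integral[of 3] p_gt_3 by simp_all

lemma divide_n_integral: "x \<in> R \<Longrightarrow> x / n \<in> R"
  using divide_of_nat_integral[of "p - 1" x] p_gt_3 by (simp add: of_nat_pred)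

lemma t_integral: "t \<in> R"
  by (intro divide_n_integral) simp

section \<open>Harmonic sums modulo \<open>p\<close>\<close>

text \<open>Pairing \<open>j\<close> with \<open>p - j\<close> gives
  \<open>1 / j + 1 / (p - j) = p / (j * (p - j))\<close>; this counts the sum twice, and 2 is a
  unit.\<close>

lemma sum_inverse_cong: "(\<Sum>j = 1..p - 1. 1 / of_nat j) \<in> I 1"
proof -
  let ?H = "\<Sum>j = 1..p - 1. 1 / rat_of_nat j"
  have "?H = (\<Sum>j = 1..p - 1. 1 / of_nat (p - j))"
    using p_gt_3 by (intro sum.reindex_bij_witness[of _ "\<lambda>j. p - j" "\<lambda>j. p - j"]) auto
  then have "?H = (\<Sum>j = 1..p - 1. 1 / of_nat j + 1 / of_nat (p - j)) / 2"
    by (simp add: sum.distrib)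
  also have "(\<Sum>j = 1..p - 1. 1 / of_nat j + 1 / rat_of_nat (p - j))
      = (\<Sum>j = 1..p - 1. q * (1 / of_nat j / of_nat (p - j)))"
    by (intro sum.cong) (auto simp: field_simps of_nat_diff)
  also have "\<dots> / 2 = q ^ 1 * ((\<Sum>j = 1..p - 1. 1 / of_nat j / of_nat (p - j)) / 2)"
    by (simp add: sum_distrib_left)
  finally show ?thesis
    by (rule p_power_idealI[rotated])
      (intro divide_2_integral p_integral_sum divide_of_nat_integral; auto)
qed

text \<open>Doubling permutes the nonzero residues and divides the sum by 4, so 3 times it vanishes.\<close>

lemma sum_inverse_square_cong: "(\<Sum>j = 1..p - 1. 1 / of_nat j ^ 2) \<in> I 1"
proof -
  let ?A = "{1..p - 1}"
  let ?d = "\<lambda>j. 2 * j mod p"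
  let ?H = "\<Sum>j\<in>?A. 1 / rat_of_nat j ^ 2"
  have p2: "coprime 2 p" using coprime_less[of 2] p_gt_3 by simp
  have ran: "?d j \<in> ?A" if "j \<in> ?A" for j
  proof -
    have "\<not> p dvd j" using that by (auto dest: dvd_imp_le)
    then have "\<not> p dvd 2 * j"
      using p2 by (simp add: coprime_commute coprime_dvd_mult_right_iff)
    then have "?d j \<noteq> 0" by (simp add: mod_eq_0_iff_dvd)
    moreover have "?d j < p" using p_gt_3 by simp
    ultimately show ?thesis by simp
  qed
  have "inj_on ?d ?A"
  proof (rule inj_onI)
    fix i j assume ij: "i \<in> ?A" "j \<in> ?A" "?d i = ?d j"
    then have "int p dvd 2 * (int i - int j)"
      by (metis (no_types, opaque_lifting) int_ops(7) mod_eq_dvd_iff of_nat_mod of_nat_numeral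
          right_diff_distrib)
    moreover have "coprime (int p) 2" using p2 by (metis coprime_commute coprime_int_iff of_nat_numeral)
    ultimately have "int p dvd int i - int j"
      using coprime_dvd_mult_right_iff by blast
    moreover have "\<bar>int i - int j\<bar> < int p" using ij by auto
    ultimately show "i = j"
      using zdvd_not_zless[of "\<bar>int i - int j\<bar>" "int p"] by fastforce
  qed
  moreover have "?d ` ?A \<subseteq> ?A" using ran by blast
  ultimately have "bij_betw ?d ?A ?A"
    by (simp add: bij_betw_def endo_inj_surj)
  then have H: "?H = (\<Sum>j\<in>?A. 1 / of_nat (?d j) ^ 2)"
    by (rule sum.reindex_bij_betw[symmetric])
  have "1 / of_nat (?d j) ^ 2 * 4 - 1 / of_nat j ^ 2 \<in> I 1" if j: "j \<in> ?A" for j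
  proof -
    \<comment> \<open>Remainder and quotient of \<open>2 * j\<close> by \<open>p\<close>: the
      difference of squares then has the factor \<open>2 * j - r = q * s\<close>.\<close>
    define r where "r = rat_of_nat (?d j)"
    define s where "s = rat_of_nat (2 * j div p)"
    have "rat_of_nat (2 * j) = of_nat (p * (2 * j div p) + ?d j)"
      by simp
    then have eq: "2 * rat_of_nat j = q * s + r"
      unfolding r_def s_def by (simp only: of_nat_add of_nat_mult of_nat_numeral)
    have nz: "r \<noteq> 0" "rat_of_nat j \<noteq> 0" using ran[OF j] j by (auto simp: r_def)
    have "1 / r ^ 2 * 4 - 1 / of_nat j ^ 2 = (2 * of_nat j - r) * (2 * of_nat j + r) / (of_nat j ^ 2 * r ^ 2)"
      using nz by (simp add: field_simps power2_eq_square)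
    also have "\<dots> = q ^ 1 * (s * (2 * of_nat j + r) / of_nat j / of_nat j / r / r)"
      by (simp add: eq power2_eq_square mult.assoc)
    finally have "1 / r ^ 2 * 4 - 1 / of_nat j ^ 2
        = q ^ 1 * (s * (2 * of_nat j + r) / of_nat j / of_nat j / r / r)" .
    moreover have "s * (2 * of_nat j + r) / of_nat j / of_nat j / r / r \<in> R"
      unfolding r_def s_def using ran[OF j] j by (intro divide_of_nat_integral) auto
    ultimately show ?thesis
      unfolding r_def[symmetric] by (intro p_power_idealI)
  qed
  then have "(\<Sum>j\<in>?A. 1 / of_nat (?d j) ^ 2 * 4 - 1 / of_nat j ^ 2) \<in> I 1"
    by (rule p_power_ideal_sum)
  moreover have "(\<Sum>j\<in>?A. 1 / of_nat (?d j) ^ 2 * 4 - 1 / rat_of_nat j ^ 2) = 4 * ?H - ?H"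
    unfolding sum_subtractf sum_distrib_right[symmetric] H[symmetric] by simp
  ultimately have "3 * ?H \<in> I 1" by simp
  then show ?thesis
    using p_power_ideal_mult[of "3 * ?H" p 1 "1 / 3"] divide_3_integral[of 1] by simp
qed

section \<open>Expansion of a step factor modulo \<open>p ^ 5\<close>\<close>

text \<open>Since \<open>t\<close> is \<open>p\<close> times a \<open>p\<close>-integral number,
  terms of index at least 5 vanish; \<open>n * t = - q\<close> simplifies the coefficients of the
  others.\<close>

lemma binomial_expansion_cong:
  assumes "x \<in> R"
  shows "(1 + t * x) ^ (p - 1) -
     (1 - q * x + q^2 * (n - 1) / (2 * n) * x^2 - q^3 * (n - 1) * (n - 2) / (6 * n^2) * x^3
      + q^4 * (n - 1) * (n - 2) * (n - 3) / (24 * n^3) * x^4) \<in> I 5"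
proof -
  let ?c = "\<lambda>i. of_nat (p - 1 choose i) * (t * x) ^ i"
  have "(1 + t * x) ^ (p - 1) = (\<Sum>i\<le>p - 1. ?c i)"
    using binomial_ring[of "t * x" 1 "p - 1"] by (simp add: add.commute)
  also have "{..p - 1} = {..<5} \<union> {5..p - 1}"
    using p_ge_5 by auto
  also have "(\<Sum>i\<in>\<dots>. ?c i) = (\<Sum>i<5. ?c i) + (\<Sum>i = 5..p - 1. ?c i)"
    by (intro sum.union_disjoint) auto
  also have "(\<Sum>i<5. ?c i) = 1 - q * x + q^2 * (n - 1) / (2 * n) * x^2
      - q^3 * (n - 1) * (n - 2) / (6 * n^2) * x^3
      + q^4 * (n - 1) * (n - 2) * (n - 3) / (24 * n^3) * x^4"
  proof -
    have c: "rat_of_nat (p - 1 choose i) = (\<Prod>j<i. n - of_nat j) / fact i" for i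
      unfolding binomial_gbinomial gbinomial_prod_rev of_nat_pred atLeast0LessThan ..
    define m where "m = n"
    have "m \<noteq> 0" using n_neq_0 by (simp add: m_def)
    then show ?thesis
      unfolding c m_def[symmetric] by (simp add: eval_nat_numeral fact_numeral field_simps)
  qed
  finally have "(1 + t * x) ^ (p - 1) - \<dots> = (\<Sum>i = 5..p - 1. ?c i)"
    by simp
  also have "\<dots> \<in> I 5"
  proof (rule p_power_ideal_sum)
    fix i assume i: "i \<in> {5..p - 1}"
    have "t * x = q * (- x / n)" by simp
    then have "(t * x) ^ i = q ^ i * (- x / n) ^ i"
      by (simp only: power_mult_distrib)
    then have "(t * x) ^ i \<in> I i"
      by (rule p_power_idealI[rotated])
        (intro p_integral_power divide_n_integral p_integral_uminus assms)
    then show "?c i \<in> I 5"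
      using i by (intro p_power_ideal_mult[OF p_power_ideal_mono[of _ p i]]) auto
  qed
  finally show ?thesis by simp
qed

text \<open>The factor \<open>1 + q * x\<close> cancels the linear term of the expansion and leaves
  a correction that starts only at \<open>q^3\<close>.\<close>

lemma step_factor_cong:
  assumes "x \<in> R"
  shows "(1 + t * x) ^ (p - 1) * (1 + q * x) -
     (1 + (q^3 + q^4) / 2 * x^2 - 2 / 3 * q^4 * x^3) \<in> I 5"
proof -
  define m where "m = n"
  have q: "q = m + 1" and m0: "m \<noteq> 0"
    using n_neq_0 by (auto simp: m_def)
  define a where "a = q^2 * (m - 1) / (2 * m)"
  define b where "b = q^3 * (m - 1) * (m - 2) / (6 * m^2)"
  define c where "c = q^4 * (m - 1) * (m - 2) * (m - 3) / (24 * m^3)"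
  define y where "y = 1 - q * x + a * x^2 - b * x^3 + c * x^4"
  have "y * (1 + q * x) - (1 + (q^3 + q^4) / 2 * x^2 - 2 / 3 * q^4 * x^3)
      = (a - q^2 - (q^3 + q^4) / 2) * x^2 + (q * a - b + 2 / 3 * q^4) * x^3
        + (c - q * b) * x^4 + q * c * x^5"
    by (simp add: y_def algebra_simps eval_nat_numeral)
  \<comment> \<open>As \<open>m = q - 1\<close>, expanding \<open>1 / m\<close> as a geometric
    series in \<open>q\<close> gives \<open>a = q^2 + (q^3 + q^4) / 2\<close> up to
    \<open>q^5\<close>. The four identities record the exact remainders, dividing by one unit at a
    time to fit the integrality rules.\<close>
  also have "a - q^2 - (q^3 + q^4) / 2 = q^5 * (- 1 / 2 / m)"
    unfolding a_def q using m0 by (simp add: divide_simps) algebra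
  also have "q * a - b + 2 / 3 * q^4 = q^5 * ((2 * m - 1) / 3 / m / m)"
    unfolding a_def b_def q using m0 by (simp add: divide_simps) algebra
  also have "c - q * b = q^5 * (- ((m - 1) * (m - 2) / 2 / 2 / 2 / m / m / m))"
    unfolding b_def c_def q using m0 by (simp add: divide_simps) algebra
  also have "q * c = q^5 * ((m - 1) * (m - 2) * (m - 3) / 2 / 2 / 2 / 3 / m / m / m)"
    unfolding c_def q using m0 by (simp add: divide_simps) algebra
  also have "q^5 * (- 1 / 2 / m) * x^2 + q^5 * ((2 * m - 1) / 3 / m / m) * x^3
      + q^5 * (- ((m - 1) * (m - 2) / 2 / 2 / 2 / m / m / m)) * x^4
      + q^5 * ((m - 1) * (m - 2) * (m - 3) / 2 / 2 / 2 / 3 / m / m / m) * x^5 \<in> I 5"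
    using assms unfolding m_def mult.assoc
    by (intro p_power_ideal_add p_power_idealI[OF _ refl] p_integral_mult p_integral_power
        p_integral_uminus divide_n_integral divide_2_integral divide_3_integral) auto
  finally have "y * (1 + q * x) - (1 + (q^3 + q^4) / 2 * x^2 - 2 / 3 * q^4 * x^3) \<in> I 5" .
  moreover have "(1 + q * x) * ((1 + t * x) ^ (p - 1) - y) \<in> I 5"
    using assms binomial_expansion_cong[OF assms]
    unfolding y_def a_def b_def c_def m_def by (intro p_power_ideal_mult) auto
  ultimately have "y * (1 + q * x) - (1 + (q^3 + q^4) / 2 * x^2 - 2 / 3 * q^4 * x^3)
      + (1 + q * x) * ((1 + t * x) ^ (p - 1) - y) \<in> I 5"
    by (rule p_power_ideal_add)
  moreover have "y * (1 + q * x) - r + (1 + q * x) * (w - y) = w * (1 + q * x) - r" for r w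
    by algebra
  ultimately show ?thesis
    by (simp only:)
qed

section \<open>The unweighted terms and their recurrence\<close>

definition F :: "nat \<Rightarrow> rat" where
  "F k = (\<Prod>j = 1..k. 1 + t / of_nat j) ^ (2 * (p - 1))"

lemma F_0 [simp]: "F 0 = 1"
  by (simp add: F_def)

lemma F_Suc: "F (Suc k) = F k * ((1 + t * (1 / of_nat (Suc k))) ^ (p - 1)) ^ 2"
  by (simp add: F_def power_mult_distrib power_mult[symmetric] mult.commute del: of_nat_Suc)

lemma F_integral: "k < p \<Longrightarrow> F k \<in> R"
  unfolding F_def
  by (intro p_integral_power p_integral_prod p_integral_add divide_of_nat_integral t_integral) auto

text \<open>Because \<open>- 1 / n = 1 + t\<close>, the \<open>j\<close>-th factor of the Pochhammer
  symbol over \<open>j\<close> is \<open>(t + j) / j\<close>.\<close>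

lemma pochhammer_eq_F: "(pochhammer (- 1 / n) k / fact k) ^ (2 * (p - 1)) = F k"
proof -
  have "- 1 / n = 1 + t"
    using n_neq_0 by (simp add: field_simps)
  then have "pochhammer (- 1 / n) k / fact k = (\<Prod>j = 1..k. 1 + t / of_nat j)"
  proof (induction k)
    case (Suc k)
    have "(1 + s + of_nat k) / of_nat (Suc k) = 1 + s / of_nat (Suc k)" for s :: rat
      by (simp add: field_simps)
    then have "(- 1 / n + of_nat k) / of_nat (Suc k) = 1 + t / of_nat (Suc k)"
      unfolding Suc.prems .
    then show ?case
      using Suc.IH[OF Suc.prems] by (simp add: pochhammer_Suc mult.commute flip: times_divide_times_eq)
  qed simp
  then show ?thesis by (simp only: F_def)
qed

text \<open>The ratio of consecutive values of \<open>F\<close> is the square of a power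
  \<open>(1 + t / j) ^ (p - 1)\<close>, so \<open>step_factor_cong\<close> at
  \<open>x = 1 / j\<close> is squared and multiplied by \<open>j^2 * F k\<close>.\<close>

lemma F_Suc_cong:
  assumes "Suc k < p"
  defines "j \<equiv> rat_of_nat (Suc k)"
  shows "(j + q)^2 * F (Suc k) - F k * (j^2 + (q^3 + q^4) - 4 / 3 * q^4 / j) \<in> I 5"
proof -
  define x where "x = 1 / j"
  define z where "z = (1 + t * x) ^ (p - 1) * (1 + q * x)"
  \<comment> \<open>The whole correction is \<open>q^3 * b\<close>; its square is divisible by
    \<open>q^6\<close> and disappears modulo \<open>q^5\<close>.\<close>
  define b where "b = (1 + q) / 2 * x^2 - 2 * q / 3 * x^3"
  have z2: "F k * j^2 * (z^2 - (1 + 2 * (q^3 * b)))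
      = (j * (1 + q * x))^2 * (F k * w^2) - F k * (j^2 + 2 * q^3 * (j^2 * b))"
    if "z = w * (1 + q * x)" for w
    using that by algebra
  have j0: "j \<noteq> 0" and jx: "j * x = 1" by (auto simp: j_def x_def simp del: of_nat_Suc)
  have x: "x \<in> R"
    unfolding x_def j_def using assms(1) by (intro divide_of_nat_integral) auto
  have b: "b \<in> R"
    unfolding b_def using x
    by (intro p_integral_diff p_integral_mult divide_2_integral divide_3_integral) auto
  have z: "z \<in> R"
    unfolding z_def using x by (intro p_integral_mult p_integral_power p_integral_add t_integral) auto
  have "1 + q^3 * b = 1 + (q^3 + q^4) / 2 * x^2 - 2 / 3 * q^4 * x^3"
    by (simp add: b_def field_simps eval_nat_numeral)
  then have "z - (1 + q^3 * b) \<in> I 5"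
    using step_factor_cong[OF x] by (simp only: z_def)
  then have "(z + (1 + q^3 * b)) * (z - (1 + q^3 * b)) + q^5 * (q * b^2) \<in> I 5"
    using b z by (intro p_power_ideal_add p_power_ideal_mult p_power_idealI[OF _ refl]) auto
  then have "F k * j^2 * ((z + (1 + q^3 * b)) * (z - (1 + q^3 * b)) + q^5 * (q * b^2)) \<in> I 5"
    using F_integral[of k] assms(1)
    by (intro p_power_ideal_mult p_integral_mult p_integral_power) (auto simp: j_def)
  also have "(z + (1 + q^3 * b)) * (z - (1 + q^3 * b)) + q^5 * (q * b^2) = z^2 - (1 + 2 * (q^3 * b))"
    by algebra
  also have "F k * j^2 * (z^2 - (1 + 2 * (q^3 * b)))
      = (j * (1 + q * x))^2 * (F k * ((1 + t * x) ^ (p - 1))^2) - F k * (j^2 + 2 * q^3 * (j^2 * b))"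
    by (rule z2) (simp add: z_def)
  also have "j * (1 + q * x) = j + q"
    using jx by (simp add: algebra_simps)
  also have "F k * ((1 + t * x) ^ (p - 1))^2 = F (Suc k)"
    by (simp add: F_Suc x_def j_def)
  also have "j^2 + 2 * q^3 * (j^2 * b) = j^2 + (q^3 + q^4) - 4 / 3 * q^4 / j"
    using j0 by (simp add: b_def x_def field_simps eval_nat_numeral)
  finally show ?thesis .
qed

text \<open>All corrections in \<open>F_Suc_cong\<close> carry \<open>q^3\<close>; this coarser
  recurrence suffices for \<open>F\<close> modulo \<open>p\<close> and for its sum modulo
  \<open>p ^ 3\<close>.\<close>

lemma F_Suc_cong_cube:
  assumes "Suc k < p"
  defines "j \<equiv> rat_of_nat (Suc k)"
  shows "(j + q)^2 * F (Suc k) - j^2 * F k \<in> I 3"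
proof -
  have "(j + q)^2 * F (Suc k) - F k * (j^2 + (q^3 + q^4) - 4 / 3 * q^4 / j) \<in> I 3"
    using F_Suc_cong[OF assms(1)] p_power_ideal_mono by (simp add: j_def)
  moreover have "q^3 * (F k * (1 + q - 4 / 3 * q / j)) \<in> I 3"
    unfolding j_def using assms(1) F_integral[of k]
    by (intro p_power_idealI[OF _ refl] p_integral_mult p_integral_diff divide_of_nat_integral
        divide_3_integral) auto
  ultimately have "(j + q)^2 * F (Suc k) - F k * (j^2 + (q^3 + q^4) - 4 / 3 * q^4 / j)
      + q^3 * (F k * (1 + q - 4 / 3 * q / j)) \<in> I 3"
    by (rule p_power_ideal_add)
  also have "(j + q)^2 * F (Suc k) - F k * (j^2 + (q^3 + q^4) - 4 / 3 * q^4 / j)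
      + q^3 * (F k * (1 + q - 4 / 3 * q / j)) = (j + q)^2 * F (Suc k) - j^2 * F k"
    by (simp add: field_simps eval_nat_numeral)
  finally show ?thesis .
qed

section \<open>Values of \<open>F\<close> modulo \<open>p\<close> and \<open>p ^ 3\<close>\<close>

text \<open>Modulo \<open>p\<close> the recurrence reads \<open>j^2 * F (Suc k) = j^2 * F k\<close>
  with \<open>j\<close> a unit, so the value 1 at 0 propagates.\<close>

lemma F_cong_1: "k < p \<Longrightarrow> F k - 1 \<in> I 1"
proof (induction k)
  case (Suc k)
  define j where "j = rat_of_nat (Suc k)"
  have j0: "j \<noteq> 0" by (simp add: j_def del: of_nat_Suc)
  have jinv: "1 / j^2 \<in> R"
    unfolding power2_eq_square j_def divide_divide_eq_left[symmetric]
    using Suc.prems by (intro divide_of_nat_integral) auto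
  have "(j + q)^2 * F (Suc k) - j^2 * F k \<in> I 1"
    unfolding j_def using p_power_ideal_mono[OF F_Suc_cong_cube[OF Suc.prems]] by simp
  moreover have "q^1 * ((2 * j + q) * F (Suc k)) \<in> I 1"
    using F_integral[OF Suc.prems] by (intro p_power_idealI[OF _ refl]) (auto simp: j_def)
  ultimately have "1 / j^2 * ((j + q)^2 * F (Suc k) - j^2 * F k - q^1 * ((2 * j + q) * F (Suc k))) \<in> I 1"
    using jinv by (intro p_power_ideal_mult[OF p_power_ideal_diff])
  also have "(j + q)^2 * F (Suc k) - j^2 * F k - q^1 * ((2 * j + q) * F (Suc k))
      = j^2 * (F (Suc k) - F k)"
    by algebra
  also have "1 / j^2 * \<dots> = F (Suc k) - F k"
    using j0 by simp
  finally show ?case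
    using p_power_ideal_add[OF _ Suc.IH] Suc.prems by fastforce
qed (simp add: p_power_ideal_0)

text \<open>Pairing \<open>j\<close> with \<open>p - j\<close> makes the first-order term of the product vanish
  to one more power of \<open>p\<close>.\<close>

lemma F_last_cong: "F (p - 1) - 1 \<in> I 3"
proof -
  let ?A = "{1..p - 1}"
  \<comment> \<open>From \<open>q + t = q * (q - 2) / n\<close> comes
    \<open>t * (q + t) = q^2 * u\<close>; one factor \<open>q\<close> is due to \<open>t\<close>,
    the other to the pair sum \<open>j + (p - j) = q\<close>.\<close>
  define u where "u = (2 - q) / n / n"
  define w where "w j = 1 / rat_of_nat j / of_nat (p - j)" for j
  have u: "u \<in> R" unfolding u_def by (intro divide_n_integral) auto
  have w: "w j \<in> R" if "j \<in> ?A" for j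
    unfolding w_def using that by (intro divide_of_nat_integral) auto
  have pair: "(1 + t / of_nat j) * (1 + t / of_nat (p - j)) = 1 + q^2 * (u * w j)" if "j \<in> ?A" for j
  proof -
    define i where "i = rat_of_nat j"
    define l where "l = rat_of_nat (p - j)"
    have il: "i + l = q" "i \<noteq> 0" "l \<noteq> 0"
      using that by (auto simp: i_def l_def of_nat_diff)
    have "(1 + s / i) * (1 + s / l) = 1 + s * ((i + l) + s) / (i * l)" for s
      using il(2,3) by (simp add: field_simps)
    then have "(1 + t / i) * (1 + t / l) = 1 + t * ((i + l) + t) / (i * l)" .
    also have "t * ((i + l) + t) = q^2 * u"
    proof -
      have "- q / m * (q + - q / m) = q^2 * ((2 - q) / m / m)" if "m \<noteq> 0" "q = m + 1" for m :: rat
        unfolding that(2) using that(1) by (simp add: field_simps power2_eq_square)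
      from this[of n] show ?thesis
        unfolding il(1) u_def using n_neq_0 by simp
    qed
    finally have "(1 + t / i) * (1 + t / l) = 1 + q^2 * u / (i * l)" .
    then show ?thesis by (simp add: w_def i_def l_def)
  qed
  \<comment> \<open>Pairing controls only the square of the product, which is enough because the
    exponent \<open>2 * (p - 1)\<close> in \<open>F\<close> is even.\<close>
  have "(\<Prod>j\<in>?A. 1 + t / of_nat j) ^ 2
      = (\<Prod>j\<in>?A. 1 + t / of_nat j) * (\<Prod>j\<in>?A. 1 + t / of_nat (p - j))"
    unfolding power2_eq_square using p_gt_3
    by (intro arg_cong2[of _ _ _ _ "(*)"] refl
        prod.reindex_bij_witness[of _ "\<lambda>j. p - j" "\<lambda>j. p - j"]) auto
  also have "\<dots> = (\<Prod>j\<in>?A. 1 + q^2 * (u * w j))"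
    by (simp only: prod.distrib[symmetric] pair cong: prod.cong)
  finally have sq: "(\<Prod>j\<in>?A. 1 + t / of_nat j) ^ 2 = (\<Prod>j\<in>?A. 1 + q^2 * (u * w j))" .
  \<comment> \<open>Modulo \<open>p\<close>, \<open>p - j\<close> is \<open>- j\<close>, so
    \<open>w j\<close> becomes \<open>- 1 / j^2\<close>.\<close>
  have "sum w ?A \<in> I 1"
  proof -
    have "w j + 1 / of_nat j ^ 2 \<in> I 1" if j: "j \<in> ?A" for j
    proof (rule p_power_idealI)
      show "1 / of_nat j / of_nat j / of_nat (p - j) \<in> R"
        using j by (intro divide_of_nat_integral) auto
      show "w j + 1 / of_nat j ^ 2 = q ^ 1 * (1 / of_nat j / of_nat j / of_nat (p - j))"
      proof -
        have "1 / i / l + 1 / i ^ 2 = (i + l) * (1 / i / i / l)" if "i \<noteq> 0" "l \<noteq> 0" for i l :: rat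
          using that by (simp add: field_simps power2_eq_square)
        from this[of "of_nat j" "of_nat (p - j)"] show ?thesis
          using j by (auto simp: w_def of_nat_diff)
      qed
    qed
    then have "(\<Sum>j\<in>?A. w j + 1 / of_nat j ^ 2) - (\<Sum>j\<in>?A. 1 / of_nat j ^ 2) \<in> I 1"
      using sum_inverse_square_cong by (intro p_power_ideal_diff[OF p_power_ideal_sum])
    then show ?thesis by (simp add: sum.distrib)
  qed
  then have "q^2 * (u * sum w ?A) \<in> I 3"
    using u p_power_ideal_mult_power[of "u * sum w ?A" p 1 2] by (simp add: p_power_ideal_mult)
  moreover have "(\<Prod>j\<in>?A. 1 + q^2 * (u * w j)) - (1 + q^2 * (\<Sum>j\<in>?A. u * w j)) \<in> I 3"
    using prod_one_plus_cong[of ?A "\<lambda>j. u * w j" p 2] u w by (auto intro: p_power_ideal_mono)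
  ultimately have "(\<Prod>j\<in>?A. 1 + q^2 * (u * w j)) - 1 \<in> I 3"
    using p_power_ideal_add by (fastforce simp: sum_distrib_left[symmetric])
  then have "((\<Prod>j\<in>?A. 1 + t / of_nat j) ^ 2) ^ (p - 1) - 1 \<in> I 3"
    unfolding sq by (rule power_cong_one)
  then show ?thesis
    by (simp only: F_def power_mult)
qed

section \<open>Sums of \<open>F\<close>, unweighted and weighted\<close>

text \<open>Modulo \<open>p\<close> each \<open>f k\<close> may be replaced by 1, which leaves the
  harmonic sum.\<close>

lemma sum_divide_cong:
  assumes "\<And>k. k < p - 1 \<Longrightarrow> f k - 1 \<in> I 1"
  shows "(\<Sum>k<p - 1. f k / of_nat (Suc k)) \<in> I 1"
proof -
  have "1 / of_nat (Suc k) * (f k - 1) \<in> I 1" if "k \<in> {..<p - 1}" for k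
    using that by (intro p_power_ideal_mult assms divide_of_nat_integral) auto
  then have "(\<Sum>k<p - 1. 1 / of_nat (Suc k) * (f k - 1)) + (\<Sum>j = 1..p - 1. 1 / of_nat j) \<in> I 1"
    by (intro p_power_ideal_add p_power_ideal_sum sum_inverse_cong)
  also have "(\<Sum>j = 1..p - 1. 1 / rat_of_nat j) = (\<Sum>k<p - 1. 1 / of_nat (Suc k))"
    by (intro sum.reindex_bij_witness[of _ Suc "\<lambda>j. j - 1"]) auto
  also have "(\<Sum>k<p - 1. 1 / of_nat (Suc k) * (f k - 1)) + \<dots> = (\<Sum>k<p - 1. f k / of_nat (Suc k))"
    unfolding sum.distrib[symmetric] by (intro sum.cong) (auto simp: right_diff_distrib)
  finally show ?thesis .
qed

lemma lessThan_p: "{..<p} = insert (p - 1) {..<p - 1}"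
  using p_gt_3 by auto

lemma sum_F_split: "sum F {..<p} = sum F {..<p - 1} + F (p - 1)"
  by (simp add: lessThan_p)

text \<open>Dividing the coarse recurrence by \<open>j\<close> and summing by parts yields
  \<open>(2 * q - 1) * S = q\<close> modulo \<open>p ^ 3\<close>, which is solved for
  \<open>S\<close>.\<close>

lemma sum_F_cong: "sum F {..<p} + q + 2 * q^2 \<in> I 3"
proof -
  define S where "S = sum F {..<p}"
  have parts: "(\<Sum>k<m. of_nat (Suc k) * (F (Suc k) - F k)) = of_nat m * F m - sum F {..<m}" for m
    by (induction m) (auto simp: algebra_simps)
  have shift: "(\<Sum>k<p - 1. F (Suc k)) = S - 1"
    using sum.lessThan_Suc_shift[of F "p - 1"] p_gt_3 by (simp add: S_def)
  define r where "r k = F (Suc k) / of_nat (Suc k)" for k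
  have r: "(\<Sum>k<p - 1. r k) \<in> I 1"
    unfolding r_def by (intro sum_divide_cong F_cong_1) auto
  have "of_nat (Suc k) * (F (Suc k) - F k) + (2 * q * F (Suc k) + q^2 * r k) \<in> I 3"
    if "k \<in> {..<p - 1}" for k
  proof -
    have "1 / of_nat (Suc k) * ((of_nat (Suc k) + q)^2 * F (Suc k) - of_nat (Suc k)^2 * F k) \<in> I 3"
      using that by (intro p_power_ideal_mult F_Suc_cong_cube divide_of_nat_integral) auto
    also have "1 / of_nat (Suc k) * ((of_nat (Suc k) + q)^2 * F (Suc k) - of_nat (Suc k)^2 * F k)
        = of_nat (Suc k) * (F (Suc k) - F k) + (2 * q * F (Suc k) + q^2 * r k)"
      unfolding r_def by (simp add: field_simps power2_eq_square del: of_nat_Suc)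
    finally show ?thesis .
  qed
  then have "(\<Sum>k<p - 1. of_nat (Suc k) * (F (Suc k) - F k) + (2 * q * F (Suc k) + q^2 * r k)) \<in> I 3"
    by (rule p_power_ideal_sum)
  also have "(\<Sum>k<p - 1. of_nat (Suc k) * (F (Suc k) - F k) + (2 * q * F (Suc k) + q^2 * r k))
      = n * F (p - 1) - (S - F (p - 1)) + (2 * q * (S - 1) + q^2 * (\<Sum>k<p - 1. r k))"
    unfolding sum.distrib parts sum_distrib_left[symmetric] shift of_nat_pred
    by (simp add: S_def sum_F_split)
  \<comment> \<open>As \<open>n + 1 = q\<close>, the last value enters as
    \<open>q * F (p - 1)\<close>, here replaced by \<open>q\<close>; the sum of the
    \<open>r k\<close> drops out since \<open>q^2\<close> multiplies it.\<close>
  finally have "n * F (p - 1) - (S - F (p - 1)) + (2 * q * (S - 1) + q^2 * (\<Sum>k<p - 1. r k))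
      - q^2 * (\<Sum>k<p - 1. r k) - q * (F (p - 1) - 1) \<in> I 3"
    using p_power_ideal_mult_power[OF r, of 2] p_power_ideal_mult[OF F_last_cong, of q]
    by (intro p_power_ideal_diff[OF p_power_ideal_diff]) auto
  also have "n * F (p - 1) - (S - F (p - 1)) + (2 * q * (S - 1) + q^2 * (\<Sum>k<p - 1. r k))
      - q^2 * (\<Sum>k<p - 1. r k) - q * (F (p - 1) - 1) = 2 * q * S - S - q"
    by (simp add: algebra_simps)
  finally have S1: "2 * q * S - S - q \<in> I 3" .
  have S: "S \<in> R"
    unfolding S_def by (intro p_integral_sum F_integral) auto
  \<comment> \<open>Reduced modulo \<open>p\<close>, the relation says that \<open>S\<close>
    vanishes; this absorbs the term \<open>4 * q^2 * S\<close> below.\<close>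
  have "q^1 * (2 * S - 1) - (2 * q * S - S - q) \<in> I 1"
    using S p_power_ideal_mono[OF S1]
    by (intro p_power_ideal_diff[OF p_power_idealI[OF _ refl]]) auto
  then have "S \<in> I 1" by (simp add: algebra_simps)
  then have "q^2 * (4 * S) \<in> I 3"
    using p_power_ideal_mult_power[of "4 * S" p 1 2] by (simp add: p_power_ideal_mult)
  \<comment> \<open>The multiplier inverts \<open>2 * q - 1\<close> up to the defect
    \<open>- 4 * q^2\<close>.\<close>
  moreover have "(- 1 - 2 * q) * (2 * q * S - S - q) \<in> I 3"
    using S1 by (intro p_power_ideal_mult) auto
  ultimately have "q^2 * (4 * S) + (- 1 - 2 * q) * (2 * q * S - S - q) \<in> I 3"
    by (rule p_power_ideal_add)
  also have "q^2 * (4 * S) + (- 1 - 2 * q) * (2 * q * S - S - q) = S + q + 2 * q^2"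
    by algebra
  finally show ?thesis by (simp only: S_def)
qed

lemma weighted_sum_F_cong: "(\<Sum>k<p. (2 * n * of_nat k - 1) * F k) \<in> I 5"
proof -
  define S where "S = sum F {..<p}"
  define T where "T = (\<Sum>k<p. (2 * n * of_nat k - 1) * F k)"
  define f where "f = F (p - 1)"
  define r where "r = (\<Sum>k<p - 1. F k / of_nat (Suc k))"
  define d where "d k = (of_nat (Suc k) + q)^2 * F (Suc k) - of_nat (Suc k) ^ 2 * F k" for k
  \<comment> \<open>Collecting the coefficient of \<open>F k\<close> gives
    \<open>(k + q)^2 - (k + 1)^2 = (2 * n * k - 1) + q^2\<close>: this produces the weight of the
    theorem.\<close>
  have parts: "(\<Sum>k<m. d k)
      = (\<Sum>k<m. (2 * n * of_nat k - 1) * F k) + q^2 * sum F {..<m} + (of_nat m + q)^2 * F m - q^2" for m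
    by (induction m) (auto simp: algebra_simps power2_eq_square d_def)
  have T: "T = (\<Sum>k<p - 1. (2 * n * of_nat k - 1) * F k) + (2 * n * n - 1) * f"
    using of_nat_pred by (simp add: T_def f_def lessThan_p)
  have "(\<Sum>k<p - 1. d k) = (T - (2 * n * n - 1) * f) + q^2 * (S - f) + (n + q)^2 * f - q^2"
    unfolding parts of_nat_pred T by (simp add: S_def f_def sum_F_split)
  \<comment> \<open>By \<open>q = n + 1\<close>, the boundary terms leave \<open>f\<close> with
    coefficient \<open>(n + q)^2 - (2 * n * n - 1) - q^2 = q^2\<close>.\<close>
  also have "\<dots> = T + q^2 * S + q^2 * (f - 1)"
    by algebra
  finally have sum_d: "(\<Sum>k<p - 1. d k) = T + q^2 * S + q^2 * (f - 1)" .
  have r: "r \<in> I 1"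
    unfolding r_def by (intro sum_divide_cong F_cong_1) auto
  have "d k - (q^3 + q^4) * F k + 4 / 3 * q^4 * (F k / of_nat (Suc k)) \<in> I 5"
    if "k \<in> {..<p - 1}" for k
    using F_Suc_cong[of k] that by (simp add: d_def algebra_simps del: of_nat_Suc)
  then have "(\<Sum>k<p - 1. d k - (q^3 + q^4) * F k + 4 / 3 * q^4 * (F k / of_nat (Suc k))) \<in> I 5"
    by (rule p_power_ideal_sum)
  also have "(\<Sum>k<p - 1. d k - (q^3 + q^4) * F k + 4 / 3 * q^4 * (F k / of_nat (Suc k)))
      = T + q^2 * S + q^2 * (f - 1) - (q^3 + q^4) * (S - f) + q^4 * (4 / 3 * r)"
    unfolding sum.distrib sum_subtractf sum_distrib_left[symmetric] sum_d r_def[symmetric]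
    by (simp add: S_def f_def sum_F_split)
  finally have 1: "T + q^2 * S + q^2 * (f - 1) - (q^3 + q^4) * (S - f) + q^4 * (4 / 3 * r) \<in> I 5" .
  have 2: "q^4 * (4 / 3 * r) \<in> I 5"
    using p_power_ideal_mult_power[OF p_power_ideal_mult[OF r], of "4 / 3" 4] divide_3_integral[of 4]
    by simp
  have f: "f - 1 \<in> I 3" unfolding f_def by (rule F_last_cong)
  have s: "S + q + 2 * q^2 \<in> I 3" unfolding S_def by (rule sum_F_cong)
  \<comment> \<open>The multipliers in \<open>3\<close> and \<open>4\<close> collect all occurrences
    of \<open>f\<close> and \<open>S\<close>, those from \<open>(q^3 + q^4) * (S - f)\<close>
    included.\<close>
  have 3: "q^2 * ((1 + (q + q^2)) * (f - 1)) \<in> I 5"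
    using p_power_ideal_mult_power[OF p_power_ideal_mult[OF f], of "1 + (q + q^2)" 2] by simp
  have 4: "q^2 * ((1 - (q + q^2)) * (S + q + 2 * q^2)) \<in> I 5"
    using p_power_ideal_mult_power[OF p_power_ideal_mult[OF s], of "1 - (q + q^2)" 2] by simp
  \<comment> \<open>With \<open>f = 1\<close> and \<open>S = - q - 2 * q^2\<close> inserted, the
    terms in \<open>q^3\<close> and \<open>q^4\<close> cancel and exactly this remains beside
    \<open>T\<close>.\<close>
  have 5: "q^5 * (3 + 2 * q) \<in> I 5"
    by (intro p_power_idealI[OF _ refl]) auto
  have "T + q^2 * S + q^2 * (f - 1) - (q^3 + q^4) * (S - f) + q^4 * (4 / 3 * r) - q^4 * (4 / 3 * r)
      - q^2 * ((1 + (q + q^2)) * (f - 1)) - q^2 * ((1 - (q + q^2)) * (S + q + 2 * q^2))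
      - q^5 * (3 + 2 * q) \<in> I 5"
    by (intro p_power_ideal_diff 1 2 3 4 5)
  also have "T + q^2 * S + q^2 * (f - 1) - (q^3 + q^4) * (S - f) + q^4 * (4 / 3 * r) - q^4 * (4 / 3 * r)
      - q^2 * ((1 + (q + q^2)) * (f - 1)) - q^2 * ((1 - (q + q^2)) * (S + q + 2 * q^2))
      - q^5 * (3 + 2 * q) = T"
    by (simp add: algebra_simps eval_nat_numeral)
  finally show ?thesis by (simp only: T_def)
qed

end

theorem theorem1p3:
  fixes p :: nat
  assumes "prime p" and "p > 3"
  shows "rat_cong p (of_nat p ^ 5)
    (\<Sum>k = 0..p - 1.
      (2 * of_nat p * of_nat k - 2 * of_nat k - 1) *
      (pochhammer (- 1 / (of_nat p - 1)) k ^ (2 * p - 2) / fact k ^ (2 * p - 2)))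
    0"
proof -
  interpret prime_gt_3 p by standard fact+
  have range: "{0..p - 1} = {..<p}" and exponent: "2 * p - 2 = 2 * (p - 1)"
    using assms(2) by auto
  let ?T = "\<Sum>k = 0..p - 1. (2 * q * of_nat k - 2 * of_nat k - 1) *
      (pochhammer (- 1 / n) k ^ (2 * p - 2) / fact k ^ (2 * p - 2))"
  have "?T = (\<Sum>k<p. (2 * n * of_nat k - 1) * F k)"
    unfolding range exponent power_divide[symmetric] pochhammer_eq_F
    by (simp add: left_diff_distrib right_diff_distrib)
  then have "?T \<in> I 5"
    using weighted_sum_F_cong by (simp only:)
  then show ?thesis
    using p_power_ideal_integral[of ?T p 5]
    unfolding rat_cong_def p_power_ideal_def by auto
qed

end
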